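(* Let $(X,d)$ be a metric space and let $\mathcal K_{\rm tot}(X)$ be equipped with the ordered Hausdorff topology. Then a set $\mathcal A\subset\mathcal K_{\rm tot}(X)$ is precompact (i.e. its closure in $\mathcal K_{\rm tot}(X)$ is compact) if and only if (i) there exists a compact $C\subset X$ such that $K\subset C$ for all $K\in\mathcal A$, and (ii) $\lim_{\varepsilon\to0}\sup_{K\in\mathcal A}m_\varepsilon(K)=0$.
   Context: $\mathcal K_{\rm tot}(X)$ is the set of pairs $(K,\preceq)$ (often just written $K$) where $K$ is a nonempty compact subset of $X$ and $\preceq$ is a total order on $K$ such that $K^{\langle 2\rangle}:=\{(x,y)\in K^2:x\preceq y\}$ is a closed subset of $K^2$. The ordered Hausdorff topology on $\mathcal K_{\rm tot}(X)$ is the topology generated by the metric $d_{\rm part}(K_1,K_2):=d^2_{\rm H}(K_1^{\langle 2\rangle},K_2^{\langle 2\rangle})$, where $d^2_{\rm H}$ is the Hausdorff metric on nonempty compact subsets of $X^2$ associated with $d^2((x_1,y_1),(x_2,y_2)):=d(x_1,x_2)\vee d(y_1,y_2)$. (Equivalently, it is generated by $d_{\rm tot}(K_1,K_2):=\inf_R\sup_{(x_1,x_2)\in R}d(x_1,x_2)$, the infimum being over correspondences $R\subset K_1\times K_2$ (both coordinate projections onto) that are monotone, i.e. there are no $(x_1,x_2),(x_1',x_2')\in R$ with $x_1\prec x_1'$ and $x_2'\prec x_2$.) The mismatch modulus is, for $K\in\mathcal K_{\rm tot}(X)$ and $\varepsilon>0$, $m_\varepsilon(K):=\sup\{d(x_1,y_1)\vee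 d(x_2,y_2):x_1,y_1,x_2,y_2\in K,\ d(x_1,x_2)\vee d(y_1,y_2)\le\varepsilon,\ x_1\preceq y_1,\ y_2\preceq x_2\}$. *)

theory Defs
  imports "HOL-Analysis.Analysis"
begin

text \<open>
  A pair \<open>(K, \<preceq>)\<close> is represented as \<open>(K, r)\<close> with \<open>r\<close> the set of all \<open>(x, y)\<close> such that
  \<open>x \<preceq> y\<close>. Since \<open>linear_order_on K r\<close> includes \<open>r \<subseteq> K \<times> K\<close>, an order on \<open>K\<close> has exactly one
  representation, so equality of pairs is the intended one.
\<close>

definition ordered_pairs :: "'a set \<times> 'a rel \<Rightarrow> ('a \<times> 'a) set" where
  "ordered_pairs P = {(x, y) \<in> fst P \<times> fst P. (x, y) \<in> snd P}"

definition K_tot :: "('a::metric_space set \<times> 'a rel) set" where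
  "K_tot = {P. compact (fst P) \<and> fst P \<noteq> {} \<and> linear_order_on (fst P) (snd P) \<and>
               closedin (top_of_set (fst P \<times> fst P)) (ordered_pairs P)}"

text \<open>
  The suprema and infima are taken in the reals; they are meaningful when \<open>A\<close> and \<open>B\<close> are
  nonempty and bounded with respect to \<open>\<delta>\<close>.
\<close>

definition hausdorff_dist :: "('b \<Rightarrow> 'b \<Rightarrow> real) \<Rightarrow> 'b set \<Rightarrow> 'b set \<Rightarrow> real" where
  "hausdorff_dist \<delta> A B =
     max (SUP a\<in>A. INF b\<in>B. \<delta> a b) (SUP b\<in>B. INF a\<in>A. \<delta> a b)"

text \<open>
  The maximum metric on the square; the library's \<open>dist\<close> on pairs is the Euclidean combination.
\<close>

definition dist2 :: "'a::metric_space \<times> 'a \<Rightarrow> 'a \<times> 'a \<Rightarrow> real" where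
  "dist2 p q = max (dist (fst p) (fst q)) (dist (snd p) (snd q))"

text \<open>
  Outside \<open>K_tot\<close> the value is set to 0 only because the locale \<open>Metric_space\<close> asks for
  nonnegativity on the whole type; the topology does not depend on these values.
\<close>

definition d_part :: "'a::metric_space set \<times> 'a rel \<Rightarrow> 'a set \<times> 'a rel \<Rightarrow> real" where
  "d_part P Q = (if P \<in> K_tot \<and> Q \<in> K_tot
                 then hausdorff_dist dist2 (ordered_pairs P) (ordered_pairs Q) else 0)"

definition ordered_hausdorff_topology :: "('a::metric_space set \<times> 'a rel) topology" where
  "ordered_hausdorff_topology = Metric_space.mtopology K_tot d_part"

text \<open>
  The modulus takes values in the extended nonnegative reals, so that the supremum over a family
  of sets is defined also when it is infinite, and is 0 for the empty family.
\<close>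

definition mismatch_modulus :: "real \<Rightarrow> 'a::metric_space set \<times> 'a rel \<Rightarrow> ennreal" where
  "mismatch_modulus \<epsilon> P =
     Sup {ennreal (max (dist x1 y1) (dist x2 y2)) | x1 y1 x2 y2.
            x1 \<in> fst P \<and> y1 \<in> fst P \<and> x2 \<in> fst P \<and> y2 \<in> fst P \<and>
            max (dist x1 x2) (dist y1 y2) \<le> \<epsilon> \<and>
            (x1, y1) \<in> snd P \<and> (y2, x2) \<in> snd P}"


subsection \<open>The function \<open>d_part\<close> is a metric on \<open>K_tot\<close>\<close>

lemma ordered_pairs_eq:
  assumes "P \<in> K_tot"
  shows "ordered_pairs P = snd P"
  using assms by (auto simp: ordered_pairs_def K_tot_def order_on_defs)

lemma ordered_pairs_compact:
  assumes "P \<in> K_tot"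
  shows "compact (ordered_pairs P)" "ordered_pairs P \<noteq> {}"
proof -
  have "compact (fst P \<times> fst P)"
    using assms by (simp add: K_tot_def compact_Times)
  then show "compact (ordered_pairs P)"
    using assms closedin_compact by (auto simp: K_tot_def)
  show "ordered_pairs P \<noteq> {}"
    using assms unfolding ordered_pairs_eq[OF assms]
    by (auto simp: K_tot_def order_on_defs refl_on_def)
qed

lemma ordered_pairs_inject:
  assumes "P \<in> K_tot" "Q \<in> K_tot" "ordered_pairs P = ordered_pairs Q"
  shows "P = Q"
proof -
  have fst_eq: "fst R = fst ` snd R" if "R \<in> K_tot" for R :: "'a set \<times> 'a rel"
    using that by (force simp: K_tot_def order_on_defs refl_on_def)
  have "snd P = snd Q"
    using assms by (simp add: ordered_pairs_eq)
  then show ?thesis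
    using fst_eq[OF assms(1)] fst_eq[OF assms(2)] by (simp add: prod_eq_iff)
qed

lemma dist2_nonneg: "0 \<le> dist2 p q"
  by (simp add: dist2_def le_max_iff_disj)

lemma dist2_commute: "dist2 p q = dist2 q p"
  by (simp add: dist2_def dist_commute)

lemma dist2_eq_0: "dist2 p q = 0 \<longleftrightarrow> p = q"
proof
  assume "dist2 p q = 0"
  then have "dist (fst p) (fst q) \<le> 0" "dist (snd p) (snd q) \<le> 0"
    unfolding dist2_def by linarith+
  then show "p = q"
    by (simp add: prod_eq_iff)
qed (simp add: dist2_def)

lemma dist2_triangle: "dist2 p r \<le> dist2 p q + dist2 q r"
  using dist_triangle[of "fst p" "fst r" "fst q"] dist_triangle[of "snd p" "snd r" "snd q"]
  by (simp add: dist2_def max_def)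

lemma dist2_le_dist: "dist2 p q \<le> dist p q"
  by (simp add: dist2_def dist_fst_le dist_snd_le)

lemma hausdorff_dist_commute:
  assumes "\<And>a b. \<delta> a b = \<delta> b a"
  shows "hausdorff_dist \<delta> A B = hausdorff_dist \<delta> B A"
proof -
  have "(SUP a\<in>S. INF b\<in>T. \<delta> a b) = (SUP a\<in>S. INF b\<in>T. \<delta> b a)" for S T
    by (subst assms) (rule refl)
  then show ?thesis
    unfolding hausdorff_dist_def by (metis max.commute)
qed

lemma INF_dist2_attained:
  fixes p :: "'a::metric_space \<times> 'a"
  assumes "compact B" "B \<noteq> {}"
  obtains b where "b \<in> B" "(INF b\<in>B. dist2 p b) = dist2 p b"
proof -
  have "continuous_on B (dist2 p)"
    unfolding dist2_def by (intro continuous_intros)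
  from continuous_attains_inf[OF assms this]
  obtain b where "b \<in> B" "\<And>c. c \<in> B \<Longrightarrow> dist2 p b \<le> dist2 p c"
    by blast
  then show thesis
    by (intro that[of b] cInf_eq_minimum) auto
qed

lemma hausdorff_dist2_witness:
  assumes "compact A" "compact B" "B \<noteq> {}" "a \<in> A"
  obtains b where "b \<in> B" "dist2 a b \<le> hausdorff_dist dist2 A B"
proof -
  obtain b0 where b0: "b0 \<in> B" using assms by blast
  obtain e where e: "\<And>x y. x \<in> A \<union> B \<Longrightarrow> y \<in> A \<union> B \<Longrightarrow> dist x y \<le> e"
    using compact_imp_bounded[OF compact_Un[OF assms(1,2)]] by (auto simp: bounded_two_points)
  have "(INF b\<in>B. dist2 x b) \<le> e" if "x \<in> A" for x
  proof (rule cINF_lower2[OF _ b0])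
    show "bdd_below (dist2 x ` B)" by (auto intro!: bdd_belowI[of _ 0] dist2_nonneg)
    show "dist2 x b0 \<le> e" using e[of x b0] that b0 dist2_le_dist[of x b0] by auto
  qed
  then have "bdd_above ((\<lambda>x. INF b\<in>B. dist2 x b) ` A)"
    by (auto intro!: bdd_aboveI[of _ e])
  then have "(INF b\<in>B. dist2 a b) \<le> hausdorff_dist dist2 A B"
    unfolding hausdorff_dist_def using assms(4) by (intro max.coboundedI1 cSUP_upper)
  with INF_dist2_attained[OF assms(2,3), of a] that show thesis by metis
qed

lemma hausdorff_dist2_le:
  assumes "A \<noteq> {}" "B \<noteq> {}"
    and "\<And>a. a \<in> A \<Longrightarrow> \<exists>b\<in>B. dist2 a b \<le> e" "\<And>b. b \<in> B \<Longrightarrow> \<exists>a\<in>A. dist2 a b \<le> e"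
  shows "hausdorff_dist dist2 A B \<le> e"
proof -
  have bdd: "bdd_below ((\<lambda>b. dist2 a b) ` S)" "bdd_below ((\<lambda>b. dist2 b a) ` S)" for a :: "'a \<times> 'a" and S
    by (auto intro!: bdd_belowI[of _ 0] dist2_nonneg)
  have "(SUP a\<in>A. INF b\<in>B. dist2 a b) \<le> e"
    using assms(1,3) by (intro cSUP_least) (meson bdd cINF_lower2)+
  moreover have "(SUP b\<in>B. INF a\<in>A. dist2 a b) \<le> e"
  proof (rule cSUP_least[OF assms(2)])
    fix b assume "b \<in> B"
    then obtain a where "a \<in> A" "dist2 a b \<le> e" using assms(4) by blast
    then show "(INF a\<in>A. dist2 a b) \<le> e" by (rule cINF_lower2[OF bdd(2)])
  qed
  ultimately show ?thesis by (simp add: hausdorff_dist_def)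
qed

lemma Metric_space_d_part: "Metric_space K_tot (d_part :: 'a::metric_space set \<times> 'a rel \<Rightarrow> _)"
proof
  fix P Q :: "'a set \<times> 'a rel"
  note cp = ordered_pairs_compact
  have H_commute: "hausdorff_dist dist2 A B = hausdorff_dist dist2 B A" for A B :: "('a \<times> 'a) set"
    by (rule hausdorff_dist_commute) (rule dist2_commute)
  have wit: "\<exists>b\<in>ordered_pairs V. dist2 a b \<le> d_part U V"
    if "U \<in> K_tot" "V \<in> K_tot" "a \<in> ordered_pairs U" for U V :: "'a set \<times> 'a rel" and a
    by (rule hausdorff_dist2_witness[of "ordered_pairs U" "ordered_pairs V" a])
       (use that cp[of U] cp[of V] in \<open>auto simp: d_part_def\<close>)
  have comm: "d_part U V = d_part V U" for U V :: "'a set \<times> 'a rel"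
    using H_commute by (simp add: d_part_def)
  show "d_part P Q = d_part Q P" by (rule comm)
  show "0 \<le> d_part P Q"
  proof (cases "P \<in> K_tot \<and> Q \<in> K_tot")
    case True
    then obtain a where a: "a \<in> ordered_pairs P" using cp(2) by blast
    obtain b where "dist2 a b \<le> d_part P Q"
      using wit[OF _ _ a, of Q] True by blast
    with dist2_nonneg[of a b] show ?thesis by simp
  qed (auto simp: d_part_def)
  show "d_part P Q = 0 \<longleftrightarrow> P = Q" if PQ: "P \<in> K_tot" "Q \<in> K_tot"
  proof
    have sub: "ordered_pairs P \<subseteq> ordered_pairs Q"
      if eq: "P \<in> K_tot" "Q \<in> K_tot" "d_part P Q = 0" for P Q :: "'a set \<times> 'a rel"
    proof
      fix a assume "a \<in> ordered_pairs P"
      then obtain b where "b \<in> ordered_pairs Q" "dist2 a b \<le> 0"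
        using wit[of P Q a] eq by auto
      then show "a \<in> ordered_pairs Q"
        by (metis dist2_nonneg dist2_eq_0 antisym)
    qed
    assume "d_part P Q = 0"
    then show "P = Q"
      using sub[of P Q] sub[of Q P] PQ comm[of P Q] by (intro ordered_pairs_inject) auto
  next
    assume "P = Q"
    have "dist2 a a \<le> 0" for a :: "'a \<times> 'a" by (simp add: dist2_def)
    then have "d_part P P \<le> 0"
      using PQ cp(2)[of P] by (auto simp: d_part_def intro!: hausdorff_dist2_le)
    with \<open>0 \<le> d_part P Q\<close> \<open>P = Q\<close> show "d_part P Q = 0" by simp
  qed
  fix R :: "'a set \<times> 'a rel"
  assume K: "P \<in> K_tot" "Q \<in> K_tot" "R \<in> K_tot"
  have step: "\<exists>c\<in>ordered_pairs R. dist2 a c \<le> d_part P Q + d_part Q R"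
    if K: "P \<in> K_tot" "Q \<in> K_tot" "R \<in> K_tot" and a: "a \<in> ordered_pairs P"
    for P Q R :: "'a set \<times> 'a rel" and a
  proof -
    obtain b where b: "b \<in> ordered_pairs Q" "dist2 a b \<le> d_part P Q"
      using wit[OF K(1,2) a] by blast
    obtain c where "c \<in> ordered_pairs R" "dist2 b c \<le> d_part Q R"
      using wit[OF K(2,3) b(1)] by blast
    with b dist2_triangle[of a c b] show ?thesis by force
  qed
  have H: "d_part U V = hausdorff_dist dist2 (ordered_pairs U) (ordered_pairs V)"
    if "U \<in> K_tot" "V \<in> K_tot" for U V :: "'a set \<times> 'a rel"
    using that by (simp add: d_part_def)
  have "hausdorff_dist dist2 (ordered_pairs P) (ordered_pairs R) \<le> d_part P Q + d_part Q R"
  proof (rule hausdorff_dist2_le)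
    show "\<exists>c\<in>ordered_pairs R. dist2 a c \<le> d_part P Q + d_part Q R" if "a \<in> ordered_pairs P" for a
      by (rule step[OF K that])
    show "\<exists>a\<in>ordered_pairs P. dist2 a c \<le> d_part P Q + d_part Q R" if "c \<in> ordered_pairs R" for c
      using step[OF K(3,2,1) that] comm[of R Q] comm[of Q P] dist2_commute[of c]
      by (simp add: add.commute)
  qed (use cp(2)[OF K(1)] cp(2)[OF K(3)] in simp_all)
  with K show "d_part P R \<le> d_part P Q + d_part Q R"
    by (simp add: H)
qed

end

theory Submission
  imports Defs
begin

text \<open>
  The argument identifies an order with its graph, so that the ordered Hausdorff metric becomes
  the Hausdorff metric on the compact graphs, and asks which Hausdorff limits of graphs of total
  orders are again graphs of total orders.

  Necessity rests on one fact, \<open>limitin_imp_convergent_subsequence\<close>: if \<open>P\<^sub>n\<close> converges to \<open>Q\<close> and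
  \<open>p\<^sub>n\<close> lies in the graph of \<open>P\<^sub>n\<close>, then a subsequence of \<open>p\<^sub>n\<close> converges to a point in the graph of
  \<open>Q\<close>. Applied to diagonal points it makes the union of all carriers over a compact family compact.
  If the mismatch moduli did not tend to 0 uniformly, it would produce in the limit two distinct
  points \<open>x\<close>, \<open>y\<close> with both \<open>(x, y)\<close> and \<open>(y, x)\<close> in the graph of \<open>Q\<close>, against antisymmetry.

  For sufficiency, a common compact carrier makes the family totally bounded, hence every
  sequence in it has a Cauchy subsequence. The Hausdorff limit of the graphs of such a
  subsequence always exists and is a closed, reflexive and total relation. It can fail to be
  antisymmetric or transitive, because points at different places in the order may merge in the
  limit. Uniform smallness of the mismatch modulus excludes such failures: each of them
  would provide points \<open>x\<^sub>1 \<preceq> y\<^sub>1\<close> and \<open>y\<^sub>2 \<preceq> x\<^sub>2\<close> with \<open>x\<^sub>1\<close>, \<open>x\<^sub>2\<close> and \<open>y\<^sub>1\<close>, \<open>y\<^sub>2\<close>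
  arbitrarily close, while the \<open>x\<close>'s stay away from the \<open>y\<close>'s.
\<close>


section \<open>Orders as graphs\<close>

lemma K_totD:
  assumes "P \<in> K_tot"
  shows "compact (fst P)" "fst P \<noteq> {}" "snd P \<subseteq> fst P \<times> fst P"
    "\<And>x. x \<in> fst P \<Longrightarrow> (x, x) \<in> snd P"
    "\<And>x y z. (x, y) \<in> snd P \<Longrightarrow> (y, z) \<in> snd P \<Longrightarrow> (x, z) \<in> snd P"
    "\<And>x y. (x, y) \<in> snd P \<Longrightarrow> (y, x) \<in> snd P \<Longrightarrow> x = y"
    "\<And>x y. x \<in> fst P \<Longrightarrow> y \<in> fst P \<Longrightarrow> (x, y) \<in> snd P \<or> (y, x) \<in> snd P"
    "compact (snd P)"
proof -
  note lin = assms[unfolded K_tot_def order_on_defs, simplified]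
  show "compact (fst P)" "fst P \<noteq> {}" "snd P \<subseteq> fst P \<times> fst P" using lin by auto
  show refl: "\<And>x. x \<in> fst P \<Longrightarrow> (x, x) \<in> snd P" using lin by (auto simp: refl_on_def)
  show "\<And>x y z. (x, y) \<in> snd P \<Longrightarrow> (y, z) \<in> snd P \<Longrightarrow> (x, z) \<in> snd P"
    using lin by (meson transD)
  show "\<And>x y. (x, y) \<in> snd P \<Longrightarrow> (y, x) \<in> snd P \<Longrightarrow> x = y"
    using lin by (meson antisymD)
  show "\<And>x y. x \<in> fst P \<Longrightarrow> y \<in> fst P \<Longrightarrow> (x, y) \<in> snd P \<or> (y, x) \<in> snd P"
    using lin refl unfolding total_on_def by metis
  show "compact (snd P)"
    using ordered_pairs_compact[OF assms] ordered_pairs_eq[OF assms] by simp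
qed

lemma dist2_Pair_less: "dist2 (x, y) (a, b) < e \<longleftrightarrow> dist x a < e \<and> dist y b < e"
  by (simp add: dist2_def)

text \<open>With \<open>dist2_le_dist\<close>, this makes the maximum metric and the library metric on pairs equivalent.\<close>

lemma dist_le_twice_dist2: "dist p q \<le> 2 * dist2 p q"
proof -
  have "dist p q \<le> dist (fst p) (fst q) + dist (snd p) (snd q)"
    unfolding dist_prod_def by (intro sqrt_sum_squares_le_sum) auto
  then show ?thesis by (auto simp: dist2_def)
qed

lemma d_part_witness:
  assumes "P \<in> K_tot" "Q \<in> K_tot" "a \<in> snd P"
  shows "\<exists>b\<in>snd Q. dist2 a b \<le> d_part P Q"
proof -
  note cp = ordered_pairs_compact
  show ?thesis
    by (rule hausdorff_dist2_witness[of "ordered_pairs P" "ordered_pairs Q" a])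
       (use assms cp[of P] cp[of Q] in \<open>auto simp: d_part_def ordered_pairs_eq\<close>)
qed

lemma d_part_le:
  assumes "P \<in> K_tot" "Q \<in> K_tot"
    and "\<And>a. a \<in> snd P \<Longrightarrow> \<exists>b\<in>snd Q. dist2 a b \<le> e" "\<And>b. b \<in> snd Q \<Longrightarrow> \<exists>a\<in>snd P. dist2 a b \<le> e"
  shows "d_part P Q \<le> e"
  using assms ordered_pairs_compact(2)[of P] ordered_pairs_compact(2)[of Q]
  by (auto simp: d_part_def ordered_pairs_eq intro!: hausdorff_dist2_le)

interpretation tot: Metric_space K_tot d_part
  by (rule Metric_space_d_part)


section \<open>Uniformly vanishing mismatch modulus\<close>

lemma mismatch_modulus_le_iff:
  assumes "0 \<le> \<delta>"
  shows "mismatch_modulus \<epsilon> P \<le> ennreal \<delta> \<longleftrightarrow>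
    (\<forall>x1\<in>fst P. \<forall>y1\<in>fst P. \<forall>x2\<in>fst P. \<forall>y2\<in>fst P.
       max (dist x1 x2) (dist y1 y2) \<le> \<epsilon> \<and> (x1, y1) \<in> snd P \<and> (y2, x2) \<in> snd P \<longrightarrow>
       max (dist x1 y1) (dist x2 y2) \<le> \<delta>)"
    (is "_ \<longleftrightarrow> ?R")
proof
  assume L: "mismatch_modulus \<epsilon> P \<le> ennreal \<delta>"
  show ?R
  proof (intro ballI impI)
    fix x1 y1 x2 y2
    assume "x1 \<in> fst P" "y1 \<in> fst P" "x2 \<in> fst P" "y2 \<in> fst P"
      "max (dist x1 x2) (dist y1 y2) \<le> \<epsilon> \<and> (x1, y1) \<in> snd P \<and> (y2, x2) \<in> snd P"
    then have "ennreal (max (dist x1 y1) (dist x2 y2)) \<le> mismatch_modulus \<epsilon> P"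
      unfolding mismatch_modulus_def by (intro Sup_upper) blast
    with L show "max (dist x1 y1) (dist x2 y2) \<le> \<delta>"
      using ennreal_le_iff[OF assms] order_trans by blast
  qed
next
  assume ?R
  then show "mismatch_modulus \<epsilon> P \<le> ennreal \<delta>"
    unfolding mismatch_modulus_def by (intro Sup_least) (blast intro: ennreal_leI)
qed

lemma mismatch_modulus_mono:
  assumes "\<epsilon> \<le> \<epsilon>'"
  shows "mismatch_modulus \<epsilon> P \<le> mismatch_modulus \<epsilon>' P"
  unfolding mismatch_modulus_def using assms by (intro Sup_subset_mono) force

text \<open>
  The vanishing of the modulus with the suprema in \<open>ennreal\<close> unfolded. Both directions of the criterion
  handle individual quadruples of points, so this is the form that they use.
\<close>

definition uniform_mismatch :: "('a::metric_space set \<times> 'a rel) set \<Rightarrow> bool" where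
  "uniform_mismatch \<A> \<longleftrightarrow> (\<forall>\<delta>>0. \<exists>\<epsilon>>0. \<forall>P\<in>\<A>. \<forall>x1\<in>fst P. \<forall>y1\<in>fst P. \<forall>x2\<in>fst P. \<forall>y2\<in>fst P.
     max (dist x1 x2) (dist y1 y2) \<le> \<epsilon> \<and> (x1, y1) \<in> snd P \<and> (y2, x2) \<in> snd P \<longrightarrow>
     max (dist x1 y1) (dist x2 y2) \<le> \<delta>)"

lemma uniform_mismatch_iff_tendsto:
  "uniform_mismatch \<A> \<longleftrightarrow> ((\<lambda>\<epsilon>. SUP P\<in>\<A>. mismatch_modulus \<epsilon> P) \<longlongrightarrow> 0) (at_right 0)"
    (is "_ \<longleftrightarrow> (?f \<longlongrightarrow> 0) _")
proof -
  have "uniform_mismatch \<A> \<longleftrightarrow> (\<forall>\<delta>>0. \<exists>\<epsilon>>0. ?f \<epsilon> \<le> ennreal \<delta>)"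
    unfolding uniform_mismatch_def SUP_le_iff by (simp add: mismatch_modulus_le_iff)
  also have "\<dots> \<longleftrightarrow> (?f \<longlongrightarrow> 0) (at_right 0)"
  proof
    assume L: "\<forall>\<delta>>0. \<exists>\<epsilon>>0. ?f \<epsilon> \<le> ennreal \<delta>"
    show "(?f \<longlongrightarrow> 0) (at_right 0)"
    proof (rule order_tendstoI)
      fix u :: ennreal assume "0 < u"
      then obtain d where d: "0 < d" "d < u" using dense by blast
      then obtain \<delta> where \<delta>: "d = ennreal \<delta>" "0 < \<delta>"
        by (cases d) (auto simp: ennreal_zero_less_top)
      then obtain \<epsilon> where \<epsilon>: "\<epsilon> > 0" "?f \<epsilon> \<le> d" using L by auto
      have "?f e < u" if "e < \<epsilon>" for e
      proof -
        have "?f e \<le> ?f \<epsilon>" using that by (intro SUP_subset_mono mismatch_modulus_mono) auto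
        with \<epsilon> d show ?thesis by (meson le_less_trans order_trans)
      qed
      then show "\<forall>\<^sub>F e in at_right 0. ?f e < u"
        using \<epsilon>(1) by (auto simp: eventually_at_right_field)
    qed simp
  next
    assume R: "(?f \<longlongrightarrow> 0) (at_right 0)"
    show "\<forall>\<delta>>0. \<exists>\<epsilon>>0. ?f \<epsilon> \<le> ennreal \<delta>"
    proof (intro allI impI)
      fix \<delta> :: real assume "\<delta> > 0"
      then have "\<forall>\<^sub>F e in at_right 0. ?f e < ennreal \<delta>"
        by (intro order_tendstoD(2)[OF R]) simp
      then obtain b where "b > 0" "\<And>e. 0 < e \<Longrightarrow> e < b \<Longrightarrow> ?f e < ennreal \<delta>"
        by (auto simp: eventually_at_right_field)
      then have "?f (b/2) \<le> ennreal \<delta>" "b/2 > 0" by (simp_all add: less_imp_le)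
      then show "\<exists>\<epsilon>>0. ?f \<epsilon> \<le> ennreal \<delta>" by blast
    qed
  qed
  finally show ?thesis .
qed


section \<open>Necessity\<close>

text \<open>
  The nearest points to \<open>p n\<close> in the graph of the limit form a sequence in a compact set, and their
  distances to \<open>p n\<close> tend to 0.
\<close>

lemma limitin_imp_convergent_subsequence:
  fixes p :: "nat \<Rightarrow> 'a::metric_space \<times> 'a"
  assumes lim: "limitin tot.mtopology P Q sequentially" and P: "\<And>n. P n \<in> K_tot"
    and p: "\<And>n. p n \<in> snd (P n)"
  obtains q and r :: "nat \<Rightarrow> nat" where "q \<in> snd Q" "strict_mono r" "(p \<circ> r) \<longlonglongrightarrow> q"
proof -
  have Q: "Q \<in> K_tot" using lim tot.limitin_mspace by blast
  have "\<exists>b\<in>snd Q. dist2 (p n) b \<le> d_part (P n) Q" for n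
    by (rule d_part_witness[OF P Q p])
  then obtain b where b: "\<And>n. b n \<in> snd Q" "\<And>n. dist2 (p n) (b n) \<le> d_part (P n) Q"
    by metis
  obtain q r where q: "q \<in> snd Q" "strict_mono r" "(b \<circ> r) \<longlonglongrightarrow> q"
    by (rule seq_compactE[of "snd Q" b])
       (use K_totD(8)[OF Q] b(1) in \<open>auto simp: compact_eq_seq_compact_metric\<close>)
  have "(\<lambda>n. d_part (P n) Q) \<longlonglongrightarrow> 0"
    using lim by (simp add: tot.limitin_metric_dist_null)
  then have "(\<lambda>n. d_part (P (r n)) Q) \<longlonglongrightarrow> 0"
    using LIMSEQ_subseq_LIMSEQ[OF _ q(2), of "\<lambda>n. d_part (P n) Q"] by (simp add: o_def)
  moreover have "(\<lambda>n. dist ((b \<circ> r) n) q) \<longlonglongrightarrow> 0"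
    by (rule tendsto_dist_iff[THEN iffD1, OF q(3)])
  ultimately have lim0: "(\<lambda>n. 2 * d_part (P (r n)) Q + dist ((b \<circ> r) n) q) \<longlonglongrightarrow> 0"
    by (intro tendsto_add_zero tendsto_mult_right_zero)
  have "dist ((p \<circ> r) n) q \<le> 2 * d_part (P (r n)) Q + dist ((b \<circ> r) n) q" for n
    using dist_triangle[of "p (r n)" q "b (r n)"] dist_le_twice_dist2[of "p (r n)" "b (r n)"]
      b(2)[of "r n"] by simp
  then have "(\<lambda>n. dist ((p \<circ> r) n) q) \<longlonglongrightarrow> 0"
    by (intro tendsto_sandwich[OF _ _ tendsto_const lim0] always_eventually allI zero_le_dist)
  then have "(p \<circ> r) \<longlonglongrightarrow> q"
    by (rule tendsto_dist_iff[THEN iffD2])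
  with q(1,2) show thesis by (rule that)
qed

lemma compactin_convergent_subsequence:
  assumes "compactin tot.mtopology \<B>" "\<And>n. P n \<in> \<B>"
  obtains Q and r :: "nat \<Rightarrow> nat" where "Q \<in> \<B>" "strict_mono r"
    "limitin tot.mtopology (P \<circ> r) Q sequentially"
proof -
  have "range P \<subseteq> \<B>" using assms(2) by blast
  with assms(1) that show thesis unfolding tot.compactin_sequentially by blast
qed

lemma compact_Union_carriers:
  assumes "compactin tot.mtopology \<B>"
  shows "compact (\<Union>P\<in>\<B>. fst P)"
  unfolding compact_eq_seq_compact_metric seq_compact_def
proof (intro allI impI)
  fix x :: "nat \<Rightarrow> 'a"
  assume "\<forall>n. x n \<in> (\<Union>P\<in>\<B>. fst P)"
  then obtain P where P: "\<And>n. P n \<in> \<B>" "\<And>n. x n \<in> fst (P n)"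
    unfolding UN_iff Bex_def by metis
  obtain Q r where Q: "Q \<in> \<B>" "strict_mono r" "limitin tot.mtopology (P \<circ> r) Q sequentially"
    using assms P(1) by (rule compactin_convergent_subsequence)
  have K: "P n \<in> K_tot" for n
    using assms P(1) unfolding tot.compactin_sequentially by blast
  have "(P \<circ> r) n \<in> K_tot" and "((x \<circ> r) n, (x \<circ> r) n) \<in> snd ((P \<circ> r) n)" for n
    using K K_totD(4)[OF K P(2)] by simp_all
  from limitin_imp_convergent_subsequence[OF Q(3) this]
  obtain q s where q: "q \<in> snd Q" "strict_mono s"
      "((\<lambda>n. ((x \<circ> r) n, (x \<circ> r) n)) \<circ> s) \<longlonglongrightarrow> q"
    by blast
  have "(x \<circ> (r \<circ> s)) \<longlonglongrightarrow> fst q"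
    using tendsto_fst[OF q(3)] by (simp add: o_def)
  moreover have "fst q \<in> fst Q"
    using Q(1) q(1) assms K_totD(3)[of Q] unfolding tot.compactin_sequentially by force
  ultimately show "\<exists>l\<in>\<Union>P\<in>\<B>. fst P. \<exists>r. strict_mono r \<and> (x \<circ> r) \<longlonglongrightarrow> l"
    using Q(1,2) q(2) strict_mono_o by blast
qed

text \<open>
  A sequence of violations with \<open>\<epsilon> = 1 / (n + 1)\<close> has a limit in which \<open>x1\<close>, \<open>x2\<close> merge into one
  point, \<open>y1\<close>, \<open>y2\<close> into another, and these two are related in both directions.
\<close>

lemma compactin_imp_uniform_mismatch:
  assumes "compactin tot.mtopology \<B>"
  shows "uniform_mismatch \<B>"
proof (rule ccontr)
  assume "\<not> uniform_mismatch \<B>"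
  then obtain \<delta> where \<delta>: "\<delta> > 0" and
    neg: "\<not> (\<exists>\<epsilon>>0. \<forall>P\<in>\<B>. \<forall>x1\<in>fst P. \<forall>y1\<in>fst P. \<forall>x2\<in>fst P. \<forall>y2\<in>fst P.
       max (dist x1 x2) (dist y1 y2) \<le> \<epsilon> \<and> (x1, y1) \<in> snd P \<and> (y2, x2) \<in> snd P \<longrightarrow>
       max (dist x1 y1) (dist x2 y2) \<le> \<delta>)" (is "\<not> (\<exists>\<epsilon>>0. ?small \<epsilon>)")
    unfolding uniform_mismatch_def by blast
  have "\<exists>P x1 y1 x2 y2. P \<in> \<B> \<and> max (dist x1 x2) (dist y1 y2) \<le> inverse (real (Suc n)) \<and>
       (x1, y1) \<in> snd P \<and> (y2, x2) \<in> snd P \<and> max (dist x1 y1) (dist x2 y2) > \<delta>" for n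
  proof (rule ccontr)
    assume neg': "\<not> ?thesis"
    have "?small (inverse (real (Suc n)))"
    proof (intro ballI impI)
      fix P x1 y1 x2 y2
      assume "P \<in> \<B>"
        "max (dist x1 x2) (dist y1 y2) \<le> inverse (real (Suc n)) \<and> (x1, y1) \<in> snd P \<and> (y2, x2) \<in> snd P"
      with neg' have "\<not> max (dist x1 y1) (dist x2 y2) > \<delta>" by blast
      then show "max (dist x1 y1) (dist x2 y2) \<le> \<delta>" by (rule leI)
    qed
    moreover have "inverse (real (Suc n)) > 0" by simp
    ultimately show False using neg by blast
  qed
  then obtain P x1 y1 x2 y2 where P: "\<And>n. P n \<in> \<B>"
    and close: "\<And>n. max (dist (x1 n) (x2 n)) (dist (y1 n) (y2 n)) \<le> inverse (real (Suc n))"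
    and xy: "\<And>n. (x1 n, y1 n) \<in> snd (P n)" and yx: "\<And>n. (y2 n, x2 n) \<in> snd (P n)"
    and far: "\<And>n. max (dist (x1 n) (y1 n)) (dist (x2 n) (y2 n)) > \<delta>"
    by metis
  obtain Q r where Q: "Q \<in> \<B>" "strict_mono r" "limitin tot.mtopology (P \<circ> r) Q sequentially"
    using assms P by (rule compactin_convergent_subsequence)
  have K: "P n \<in> K_tot" "Q \<in> K_tot" for n
    using assms P Q unfolding tot.compactin_sequentially by blast+
  have "(P \<circ> r) n \<in> K_tot" "(x1 (r n), y1 (r n)) \<in> snd ((P \<circ> r) n)" for n
    using K xy by simp_all
  from limitin_imp_convergent_subsequence[OF Q(3) this]
  obtain p s where p: "p \<in> snd Q" "strict_mono s" "((\<lambda>n. (x1 (r n), y1 (r n))) \<circ> s) \<longlonglongrightarrow> p"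
    by blast
  have Q': "limitin tot.mtopology (P \<circ> r \<circ> s) Q sequentially"
    by (rule limitin_subsequence[OF p(2) Q(3)])
  have "(P \<circ> r \<circ> s) n \<in> K_tot" "(y2 (r (s n)), x2 (r (s n))) \<in> snd ((P \<circ> r \<circ> s) n)" for n
    using K yx by simp_all
  from limitin_imp_convergent_subsequence[OF Q' this]
  obtain q t where q: "q \<in> snd Q" "strict_mono t"
      "((\<lambda>n. (y2 (r (s n)), x2 (r (s n)))) \<circ> t) \<longlonglongrightarrow> q"
    by blast
  define k where "k = r \<circ> s \<circ> t"
  have k: "strict_mono k" unfolding k_def by (intro strict_mono_o Q p q)
  have p': "(\<lambda>n. (x1 (k n), y1 (k n))) \<longlonglongrightarrow> p"
    using LIMSEQ_subseq_LIMSEQ[OF p(3) q(2)] by (simp add: o_def k_def)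
  have x1: "(\<lambda>n. x1 (k n)) \<longlonglongrightarrow> fst p" and y1: "(\<lambda>n. y1 (k n)) \<longlonglongrightarrow> snd p"
    using tendsto_fst[OF p'] tendsto_snd[OF p'] by simp_all
  have y2: "(\<lambda>n. y2 (k n)) \<longlonglongrightarrow> fst q" and x2: "(\<lambda>n. x2 (k n)) \<longlonglongrightarrow> snd q"
    using tendsto_fst[OF q(3)] tendsto_snd[OF q(3)] by (simp_all add: o_def k_def)
  have z: "(\<lambda>n. inverse (real (Suc (k n)))) \<longlonglongrightarrow> 0"
    using LIMSEQ_subseq_LIMSEQ[OF LIMSEQ_inverse_real_of_nat k] by (simp add: o_def)
  have "dist (fst p) (snd q) \<le> 0"
    by (rule tendsto_le[OF _ z tendsto_dist[OF x1 x2]])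
       (use close in \<open>auto intro!: always_eventually\<close>)
  moreover have "dist (snd p) (fst q) \<le> 0"
    by (rule tendsto_le[OF _ z tendsto_dist[OF y1 y2]])
       (use close in \<open>auto intro!: always_eventually\<close>)
  ultimately have "q = (snd p, fst p)" by (simp add: prod_eq_iff)
  then have eq: "fst p = snd p"
    using p(1) q(1) K_totD(6)[OF K(2)] by (metis prod.collapse)
  have "(\<lambda>n. max (dist (x1 (k n)) (y1 (k n))) (dist (x2 (k n)) (y2 (k n)))) \<longlonglongrightarrow>
          max (dist (fst p) (snd p)) (dist (snd q) (fst q))"
    by (intro tendsto_intros x1 x2 y1 y2)
  moreover have "max (dist (fst p) (snd p)) (dist (snd q) (fst q)) = 0"
    using eq \<open>q = _\<close> by simp
  ultimately have "(\<lambda>n. max (dist (x1 (k n)) (y1 (k n))) (dist (x2 (k n)) (y2 (k n)))) \<longlonglongrightarrow> 0"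
    by (rule subst[rotated])
  then have "\<delta> \<le> 0"
    by (rule LIMSEQ_le_const) (intro exI allI impI less_imp_le far)
  with \<delta> show False by simp
qed


section \<open>Total boundedness\<close>

text \<open>
  A graph contained in a compact square is determined, up to a Hausdorff error, by which points of
  a finite net it comes close to, and there are finitely many such traces.
\<close>

lemma mtotally_bounded_common_carrier:
  fixes \<A> :: "('a::metric_space set \<times> 'a rel) set"
  assumes "\<A> \<subseteq> K_tot" "compact C" "\<And>P. P \<in> \<A> \<Longrightarrow> fst P \<subseteq> C"
  shows "tot.mtotally_bounded \<A>"
  unfolding tot.mtotally_bounded_def
proof (intro allI impI)
  fix e :: real assume "e > 0"
  obtain F where F: "finite F" "C \<times> C \<subseteq> (\<Union>f\<in>F. ball f (e/4))"
    using compact_Times[OF assms(2,2)] \<open>e > 0\<close>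
    unfolding compact_eq_totally_bounded by (meson divide_pos_pos zero_less_numeral)
  define T where "T P = {f \<in> F. \<exists>p\<in>snd P. dist f p < e/4}" for P :: "'a set \<times> 'a rel"
  have "T ` \<A> \<subseteq> Pow F" by (auto simp: T_def)
  then have "finite (T ` \<A>)" using F(1) by (meson finite_Pow_iff finite_subset)
  then obtain \<K> where \<K>: "\<K> \<subseteq> \<A>" "finite \<K>" "T ` \<A> = T ` \<K>"
    by (metis finite_subset_image subset_refl)
  have near: "\<exists>b\<in>snd Q. dist2 a b \<le> e/2"
    if "P \<in> \<A>" "T P = T Q" "a \<in> snd P" for P Q a
  proof -
    have "a \<in> C \<times> C" using that assms K_totD(3)[of P] by blast
    then obtain f where f: "f \<in> F" "dist f a < e/4" using F(2) by auto
    then have "f \<in> T Q" using that unfolding T_def by blast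
    then obtain b where "b \<in> snd Q" "dist f b < e/4" unfolding T_def by blast
    moreover have "dist2 a b \<le> dist f a + dist f b"
      using dist2_le_dist[of a b] dist_triangle3[of a b f] by linarith
    ultimately show ?thesis using f by force
  qed
  have *: "\<exists>Q\<in>\<K>. d_part Q P < e" if "P \<in> \<A>" for P
  proof -
    have "T P \<in> T ` \<K>" using that by (simp flip: \<K>(3))
    then obtain Q where Q: "Q \<in> \<K>" "T P = T Q" by blast
    have "d_part Q P \<le> e/2"
    proof (rule d_part_le)
      show "Q \<in> K_tot" "P \<in> K_tot" using that Q \<K> assms by auto
      show "\<exists>b\<in>snd P. dist2 a b \<le> e/2" if "a \<in> snd Q" for a
        using near[of Q P a] Q \<K> that by auto
      show "\<exists>a\<in>snd Q. dist2 a b \<le> e/2" if "b \<in> snd P" for b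
        using near[of P Q b] \<open>P \<in> \<A>\<close> Q that by (metis dist2_commute)
    qed
    with \<open>e > 0\<close> Q show ?thesis by force
  qed
  have "\<A> \<subseteq> (\<Union>Q\<in>\<K>. tot.mball Q e)"
  proof
    fix P assume "P \<in> \<A>"
    with * obtain Q where "Q \<in> \<K>" "d_part Q P < e" by blast
    moreover have "P \<in> K_tot" "Q \<in> K_tot" using \<open>P \<in> \<A>\<close> \<open>Q \<in> \<K>\<close> \<K>(1) assms(1) by blast+
    ultimately show "P \<in> (\<Union>Q\<in>\<K>. tot.mball Q e)" by (simp only: UN_iff tot.in_mball) blast
  qed
  with \<K> show "\<exists>K. finite K \<and> K \<subseteq> \<A> \<and> \<A> \<subseteq> (\<Union>x\<in>K. tot.mball x e)" by blast
qed


section \<open>Limits of Cauchy sequences\<close>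

text \<open>
  The lower Kuratowski limit of the graphs. For a Cauchy sequence in a common compact carrier it is
  the Hausdorff limit.
\<close>

definition graph_limit :: "(nat \<Rightarrow> 'a::metric_space set \<times> 'a rel) \<Rightarrow> ('a \<times> 'a) set" where
  "graph_limit P = {p. \<forall>e>0. \<forall>\<^sub>F n in sequentially. \<exists>q\<in>snd (P n). dist2 p q < e}"

lemma graph_limit_eventually:
  assumes "p \<in> graph_limit P" "e > 0"
  shows "\<forall>\<^sub>F n in sequentially. \<exists>q\<in>snd (P n). dist2 p q < e"
  using assms unfolding graph_limit_def by blast

lemma graph_limitD:
  assumes "(x, y) \<in> graph_limit P" "e > 0"
  shows "\<forall>\<^sub>F n in sequentially. \<exists>a b. (a, b) \<in> snd (P n) \<and> dist x a < e \<and> dist y b < e"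
proof -
  have "\<forall>\<^sub>F n in sequentially. \<exists>q\<in>snd (P n). dist2 (x, y) q < e"
    by (rule graph_limit_eventually[OF assms])
  then show ?thesis
  proof eventually_elim
    case (elim n)
    then obtain q where "q \<in> snd (P n)" "dist2 (x, y) q < e" by blast
    then show ?case by (cases q) (metis dist2_Pair_less)
  qed
qed

text \<open>
  A single graph with a late index that comes close to \<open>p\<close> forces all later graphs to do so. Hence the
  upper and the lower Kuratowski limit of a Cauchy sequence agree.
\<close>

lemma graph_limit_frequently:
  assumes cau: "tot.MCauchy P"
    and freq: "\<And>e. e > 0 \<Longrightarrow> \<exists>\<^sub>F n in sequentially. \<exists>q\<in>snd (P n). dist2 p q < e"
  shows "p \<in> graph_limit P"
  unfolding graph_limit_def
proof (intro CollectI allI impI)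
  fix e :: real assume "e > 0"
  have K: "P n \<in> K_tot" for n using cau unfolding tot.MCauchy_def by blast
  obtain N where N: "\<And>m n. m \<ge> N \<Longrightarrow> n \<ge> N \<Longrightarrow> d_part (P m) (P n) < e/2"
    using cau \<open>e > 0\<close> unfolding tot.MCauchy_def by (meson half_gt_zero)
  obtain m q where m: "m \<ge> N" "q \<in> snd (P m)" "dist2 p q < e/2"
    using freq[of "e/2"] \<open>e > 0\<close> unfolding frequently_sequentially by (meson half_gt_zero)
  have "\<exists>b\<in>snd (P n). dist2 p b < e" if "n \<ge> N" for n
  proof -
    obtain b where b: "b \<in> snd (P n)" "dist2 q b \<le> d_part (P m) (P n)"
      using d_part_witness[OF K K m(2)] by blast
    have "dist2 p b < e"
      using dist2_triangle[of p b q] b(2) m(3) N[OF m(1) that] by linarith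
    with b show ?thesis by blast
  qed
  then show "\<forall>\<^sub>F n in sequentially. \<exists>q\<in>snd (P n). dist2 p q < e"
    unfolding eventually_sequentially by blast
qed

lemma not_graph_limitD:
  assumes "tot.MCauchy P" "(x, y) \<notin> graph_limit P"
  obtains e where "e > 0"
    "\<forall>\<^sub>F n in sequentially. \<forall>a b. (a, b) \<in> snd (P n) \<longrightarrow> \<not> (dist x a < e \<and> dist y b < e)"
proof -
  obtain e where "e > 0" and e: "\<not> (\<exists>\<^sub>F n in sequentially. \<exists>q\<in>snd (P n). dist2 (x, y) q < e)"
    using graph_limit_frequently[OF assms(1)] assms(2) by blast
  from e have "\<forall>\<^sub>F n in sequentially. \<forall>a b. (a, b) \<in> snd (P n) \<longrightarrow> \<not> (dist x a < e \<and> dist y b < e)"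
    unfolding not_frequently by (rule eventually_mono) (metis dist2_Pair_less)
  with \<open>e > 0\<close> that show thesis by blast
qed

lemma graph_limit_subset:
  assumes "\<And>n. P n \<in> K_tot" "\<And>n. fst (P n) \<subseteq> C" "compact C"
  shows "graph_limit P \<subseteq> C \<times> C"
proof
  fix p assume p: "p \<in> graph_limit P"
  have "\<exists>q\<in>C \<times> C. dist q p < e" if "e > 0" for e
  proof -
    have "\<forall>\<^sub>F n in sequentially. \<exists>q\<in>snd (P n). dist2 p q < e/2"
      using p that by (intro graph_limit_eventually half_gt_zero)
    then obtain n q where "q \<in> snd (P n)" "dist2 p q < e/2"
      unfolding eventually_sequentially by blast
    moreover have "dist q p < e"
      using dist_le_twice_dist2[of q p] calculation(2) by (simp add: dist2_commute)
    ultimately show ?thesis using K_totD(3)[OF assms(1)[of n]] assms(2)[of n] by blast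
  qed
  then have "p \<in> closure (C \<times> C)" by (simp add: closure_approachable)
  then show "p \<in> C \<times> C"
    using assms(3) by (simp add: closure_Times compact_imp_closed)
qed

lemma closed_graph_limit: "closed (graph_limit P)"
proof -
  have "p \<in> graph_limit P" if p: "p \<in> closure (graph_limit P)" for p
    unfolding graph_limit_def
  proof (intro CollectI allI impI)
    fix e :: real assume "e > 0"
    obtain q where q: "q \<in> graph_limit P" "dist q p < e/2"
      using p half_gt_zero[OF \<open>e > 0\<close>] unfolding closure_approachable by blast
    have "\<forall>\<^sub>F n in sequentially. \<exists>a\<in>snd (P n). dist2 q a < e/2"
      using q(1) \<open>e > 0\<close> by (intro graph_limit_eventually half_gt_zero)
    then show "\<forall>\<^sub>F n in sequentially. \<exists>a\<in>snd (P n). dist2 p a < e"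
    proof eventually_elim
      case (elim n)
      then obtain a where "a \<in> snd (P n)" "dist2 q a < e/2" by blast
      moreover have "dist2 p a < e"
        using dist2_triangle[of p a q] dist2_le_dist[of p q] q(2) calculation(2)
        by (simp add: dist_commute)
      ultimately show ?case by blast
    qed
  qed
  then show ?thesis by (metis closure_subset_eq subsetI)
qed

text \<open>
  Points of the later graphs close to the given one accumulate by compactness, and by
  \<open>graph_limit_frequently\<close> an accumulation point is a limit point.
\<close>

lemma graph_limit_near:
  assumes cau: "tot.MCauchy P" and C: "compact C" "\<And>n. fst (P n) \<subseteq> C"
    and N: "\<And>n. n \<ge> N \<Longrightarrow> d_part (P N) (P n) < e" and a: "a \<in> snd (P N)"
  obtains p where "p \<in> graph_limit P" "dist2 a p \<le> e"
proof -
  have K: "P n \<in> K_tot" for n using cau unfolding tot.MCauchy_def by blast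
  have "\<exists>b\<in>snd (P (N + n)). dist2 a b \<le> e" for n
    using N[of "N + n"] d_part_witness[OF K K a, of "N + n"] by force
  then obtain b where b: "\<And>n. b n \<in> snd (P (N + n))" "\<And>n. dist2 a (b n) \<le> e" by metis
  have "\<forall>n. b n \<in> C \<times> C"
  proof
    fix n
    have "snd (P (N + n)) \<subseteq> C \<times> C"
      using K_totD(3)[OF K] Sigma_mono[OF C(2) C(2)] by (rule order_trans)
    with b(1) show "b n \<in> C \<times> C" by (rule subsetD[rotated])
  qed
  moreover have "seq_compact (C \<times> C)"
    using compact_Times[OF C(1,1)] unfolding compact_eq_seq_compact_metric .
  ultimately obtain p r where p: "strict_mono r" "(b \<circ> r) \<longlonglongrightarrow> p"
    by (elim seq_compactE)
  have near: "\<forall>\<^sub>F n in sequentially. dist2 p (b (r n)) < \<eta>" if "\<eta> > 0" for \<eta>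
  proof -
    have "\<forall>\<^sub>F n in sequentially. dist (b (r n)) p < \<eta>"
      using p(2) that by (auto simp: tendsto_iff)
    then show ?thesis
      by eventually_elim (metis dist2_le_dist dist_commute le_less_trans)
  qed
  have "p \<in> graph_limit P"
  proof (rule graph_limit_frequently[OF cau])
    fix \<eta> :: real assume "\<eta> > 0"
    show "\<exists>\<^sub>F n in sequentially. \<exists>q\<in>snd (P n). dist2 p q < \<eta>"
      unfolding frequently_sequentially
    proof
      fix M
      obtain n0 where "\<And>n. n \<ge> n0 \<Longrightarrow> dist2 p (b (r n)) < \<eta>"
        using near[OF \<open>\<eta> > 0\<close>] unfolding eventually_sequentially by blast
      then have "dist2 p (b (r (max n0 M))) < \<eta>" by simp
      moreover have "M \<le> N + r (max n0 M)"
        using seq_suble[OF p(1), of "max n0 M"] by linarith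
      ultimately show "\<exists>n\<ge>M. \<exists>q\<in>snd (P n). dist2 p q < \<eta>" using b(1) by blast
    qed
  qed
  moreover have "dist2 a p \<le> e"
  proof (rule field_le_epsilon)
    fix \<eta> :: real assume "\<eta> > 0"
    then obtain n where n: "dist2 p (b (r n)) < \<eta>"
      using near unfolding eventually_sequentially by blast
    show "dist2 a p \<le> e + \<eta>"
      using dist2_triangle[of a p "b (r n)"] b(2)[of "r n"] n by (simp add: dist2_commute)
  qed
  ultimately show thesis by (rule that)
qed

lemma refl_graph_limit:
  assumes "\<And>n. P n \<in> K_tot" "(x, y) \<in> graph_limit P"
  shows "(x, x) \<in> graph_limit P" "(y, y) \<in> graph_limit P"
proof -
  have "\<forall>\<^sub>F n in sequentially. (\<exists>q\<in>snd (P n). dist2 (x, x) q < e) \<and> (\<exists>q\<in>snd (P n). dist2 (y, y) q < e)"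
    if "e > 0" for e
    using graph_limitD[OF assms(2) that]
  proof eventually_elim
    case (elim n)
    then obtain a b where ab: "(a, b) \<in> snd (P n)" "dist x a < e" "dist y b < e" by blast
    then have "(a, a) \<in> snd (P n)" "(b, b) \<in> snd (P n)"
      using K_totD(3,4)[OF assms(1)[of n]] by auto
    with ab show ?case by (meson dist2_Pair_less)
  qed
  then show "(x, x) \<in> graph_limit P" "(y, y) \<in> graph_limit P"
    unfolding graph_limit_def eventually_conj_iff by blast+
qed

text \<open>
  Points of the \<open>n\<close>-th carrier that approximate \<open>x\<close> and \<open>y\<close> are comparable, although the direction may
  depend on \<open>n\<close>. By \<open>not_graph_limitD\<close>, a pair outside the limit has its direction excluded for all
  large \<open>n\<close>, so \<open>(x, y)\<close> and \<open>(y, x)\<close> cannot both be outside.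
\<close>

lemma total_graph_limit:
  assumes cau: "tot.MCauchy P" and "(x, x) \<in> graph_limit P" "(y, y) \<in> graph_limit P"
  shows "(x, y) \<in> graph_limit P \<or> (y, x) \<in> graph_limit P"
proof (rule ccontr)
  have K: "P n \<in> K_tot" for n using cau unfolding tot.MCauchy_def by blast
  assume neg: "\<not> ?thesis"
  obtain e1 where e1: "e1 > 0" "\<forall>\<^sub>F n in sequentially. \<forall>a b. (a, b) \<in> snd (P n) \<longrightarrow>
      \<not> (dist x a < e1 \<and> dist y b < e1)"
    using not_graph_limitD[OF cau] neg by blast
  obtain e2 where e2: "e2 > 0" "\<forall>\<^sub>F n in sequentially. \<forall>a b. (a, b) \<in> snd (P n) \<longrightarrow>
      \<not> (dist y a < e2 \<and> dist x b < e2)"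
    using not_graph_limitD[OF cau] neg by blast
  define e where "e = min e1 e2"
  have "e > 0" using e1 e2 by (simp add: e_def)
  note ev = graph_limitD[OF assms(2) \<open>e > 0\<close>] graph_limitD[OF assms(3) \<open>e > 0\<close>]
  have "\<forall>\<^sub>F n in sequentially. False"
    using ev e1(2) e2(2)
  proof eventually_elim
    case (elim n)
    obtain a where a: "a \<in> fst (P n)" "dist x a < e"
      using elim(1) K_totD(3)[OF K[of n]] by blast
    obtain b where b: "b \<in> fst (P n)" "dist y b < e"
      using elim(2) K_totD(3)[OF K[of n]] by blast
    show False
      using K_totD(7)[OF K a(1) b(1)] elim(3,4) a(2) b(2) by (auto simp: e_def)
  qed
  then show False by simp
qed

text \<open>
  The common core of antisymmetry and transitivity. The eventual condition provides quadruples as in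
  the mismatch condition at arbitrarily small scale, with \<open>x2\<close> and \<open>y2\<close> approximating \<open>x\<close> and \<open>y\<close>. The
  mismatch condition makes \<open>dist x2 y2\<close> small, hence \<open>dist x y\<close>.
\<close>

lemma eq_if_approx_mismatch:
  assumes mm: "uniform_mismatch (range P)" and K: "\<And>n. P n \<in> K_tot"
    and ev: "\<And>e. e > 0 \<Longrightarrow> \<forall>\<^sub>F n in sequentially. \<exists>x1 y1 x2 y2. (x1, y1) \<in> snd (P n) \<and>
      (y2, x2) \<in> snd (P n) \<and> dist x1 x2 < e \<and> dist y1 y2 < e \<and> dist x x2 < e \<and> dist y y2 < e"
  shows "x = y"
proof -
  have "dist x y \<le> 0"
  proof (rule field_le_epsilon)
    fix \<delta> :: real assume "\<delta> > 0"
    then obtain \<epsilon> where \<epsilon>: "\<epsilon> > 0"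
      "\<And>n x1 y1 x2 y2. max (dist x1 x2) (dist y1 y2) \<le> \<epsilon> \<Longrightarrow> (x1, y1) \<in> snd (P n) \<Longrightarrow>
        (y2, x2) \<in> snd (P n) \<Longrightarrow> max (dist x1 y1) (dist x2 y2) \<le> \<delta>/3"
    proof -
      have "\<delta>/3 > 0" using \<open>\<delta> > 0\<close> by simp
      then obtain \<epsilon> where "\<epsilon> > 0" and H: "\<forall>P\<in>range P. \<forall>x1\<in>fst P. \<forall>y1\<in>fst P. \<forall>x2\<in>fst P. \<forall>y2\<in>fst P.
         max (dist x1 x2) (dist y1 y2) \<le> \<epsilon> \<and> (x1, y1) \<in> snd P \<and> (y2, x2) \<in> snd P \<longrightarrow>
         max (dist x1 y1) (dist x2 y2) \<le> \<delta>/3"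
        using mm unfolding uniform_mismatch_def by meson
      show thesis
      proof (rule that[OF \<open>\<epsilon> > 0\<close>])
        fix n x1 y1 x2 y2
        assume h: "max (dist x1 x2) (dist y1 y2) \<le> \<epsilon>" "(x1, y1) \<in> snd (P n)" "(y2, x2) \<in> snd (P n)"
        then have "x1 \<in> fst (P n)" "y1 \<in> fst (P n)" "x2 \<in> fst (P n)" "y2 \<in> fst (P n)"
          using K_totD(3)[OF K[of n]] by auto
        with h H show "max (dist x1 y1) (dist x2 y2) \<le> \<delta>/3" by blast
      qed
    qed
    define e where "e = min \<epsilon> (\<delta>/3)"
    have "e > 0" using \<epsilon> \<open>\<delta> > 0\<close> by (simp add: e_def)
    then obtain n x1 y1 x2 y2 where h: "(x1, y1) \<in> snd (P n)" "(y2, x2) \<in> snd (P n)"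
      "dist x1 x2 < e" "dist y1 y2 < e" "dist x x2 < e" "dist y y2 < e"
      using ev unfolding eventually_sequentially by blast
    have "max (dist x1 y1) (dist x2 y2) \<le> \<delta>/3"
      using h by (intro \<epsilon>(2)[of _ _ _ _ n]) (auto simp: e_def)
    then have "dist x2 y2 \<le> \<delta>/3" by simp
    moreover have "e \<le> \<delta>/3" by (simp add: e_def)
    moreover have "dist x y \<le> dist x x2 + dist x2 y2 + dist y y2"
      using dist_triangle[of x y x2] dist_triangle2[of x2 y y2] by linarith
    ultimately show "dist x y \<le> 0 + \<delta>" using h by linarith
  qed
  then show ?thesis by simp
qed

lemma antisym_graph_limit:
  assumes mm: "uniform_mismatch (range P)" and K: "\<And>n. P n \<in> K_tot"
    and "(x, y) \<in> graph_limit P" "(y, x) \<in> graph_limit P"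
  shows "x = y"
proof (rule eq_if_approx_mismatch[OF mm K])
  fix e :: real assume "e > 0"
  then have "e/2 > 0" by simp
  from graph_limitD[OF assms(3) this] graph_limitD[OF assms(4) this]
  show "\<forall>\<^sub>F n in sequentially. \<exists>x1 y1 x2 y2. (x1, y1) \<in> snd (P n) \<and>
      (y2, x2) \<in> snd (P n) \<and> dist x1 x2 < e \<and> dist y1 y2 < e \<and> dist x x2 < e \<and> dist y y2 < e"
  proof eventually_elim
    case (elim n)
    then obtain x1 y1 x2 y2 where h: "(x1, y1) \<in> snd (P n)" "dist x x1 < e/2" "dist y y1 < e/2"
       "(y2, x2) \<in> snd (P n)" "dist y y2 < e/2" "dist x x2 < e/2" by blast
    have "dist x1 x2 < e" "dist y1 y2 < e"
      using h dist_triangle3[of x1 x2 x] dist_triangle3[of y1 y2 y] by linarith+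
    with h \<open>e > 0\<close> show ?case by force
  qed
qed

text \<open>
  If \<open>(x, z)\<close> were missing, then the approximations \<open>a \<preceq> b\<close> of \<open>(x, y)\<close> and \<open>c \<preceq> d\<close> of \<open>(y, z)\<close> would
  satisfy \<open>c \<preceq> d \<preceq> a \<preceq> b\<close> with \<open>b\<close>, \<open>c\<close> close to each other. The mismatch condition for \<open>c \<preceq> a\<close>
  and \<open>a \<preceq> b\<close> then forces \<open>x = y\<close>, so that \<open>(x, z) = (y, z)\<close>.
\<close>

lemma trans_graph_limit:
  assumes mm: "uniform_mismatch (range P)" and cau: "tot.MCauchy P"
    and xy: "(x, y) \<in> graph_limit P" and yz: "(y, z) \<in> graph_limit P"
  shows "(x, z) \<in> graph_limit P"
proof (rule ccontr)
  have K: "P n \<in> K_tot" for n using cau unfolding tot.MCauchy_def by blast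
  assume neg: "(x, z) \<notin> graph_limit P"
  then obtain e0 where e0: "e0 > 0" "\<forall>\<^sub>F n in sequentially. \<forall>a b. (a, b) \<in> snd (P n) \<longrightarrow>
      \<not> (dist x a < e0 \<and> dist z b < e0)"
    using not_graph_limitD[OF cau] by blast
  have "y = x"
  proof (rule eq_if_approx_mismatch[OF mm K])
    fix e :: real assume "e > 0"
    define e' where "e' = min e0 (e/2)"
    have "e' > 0" using \<open>e > 0\<close> e0 by (simp add: e'_def)
    from graph_limitD[OF xy this] graph_limitD[OF yz this] e0(2)
    show "\<forall>\<^sub>F n in sequentially. \<exists>x1 y1 x2 y2. (x1, y1) \<in> snd (P n) \<and>
      (y2, x2) \<in> snd (P n) \<and> dist x1 x2 < e \<and> dist y1 y2 < e \<and> dist y x2 < e \<and> dist x y2 < e"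
    proof eventually_elim
      case (elim n)
      then obtain a b c d where h: "(a, b) \<in> snd (P n)" "dist x a < e'" "dist y b < e'"
         "(c, d) \<in> snd (P n)" "dist y c < e'" "dist z d < e'" by blast
      have "a \<in> fst (P n)" "d \<in> fst (P n)" using h K_totD(3)[OF K[of n]] by auto
      moreover have "(a, d) \<notin> snd (P n)" using elim(3) h by (auto simp: e'_def)
      ultimately have "(d, a) \<in> snd (P n)" using K_totD(7)[OF K] by blast
      then have "(c, a) \<in> snd (P n)" using K_totD(5)[OF K h(4)] by blast
      moreover have "dist c b < e" "dist y b < e" "dist x a < e"
        using h dist_triangle3[of c b y] \<open>e > 0\<close> by (auto simp: e'_def)
      ultimately show ?case using h(1) \<open>e > 0\<close> by (metis dist_self)
    qed
  qed
  with neg yz show False by simp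
qed

text \<open>
  The graphs converge to \<open>graph_limit P\<close> by the Cauchy property and the compactness of \<open>C\<close>. The mismatch
  condition is what makes this limit the graph of an order.
\<close>

lemma MCauchy_limit_exists:
  assumes mm: "uniform_mismatch (range P)" and cau: "tot.MCauchy P"
    and C: "compact C" "\<And>n. fst (P n) \<subseteq> C"
  obtains Q where "limitin tot.mtopology P Q sequentially"
proof -
  have K: "P n \<in> K_tot" for n using cau unfolding tot.MCauchy_def by blast
  define R where "R = graph_limit P"
  define Q where "Q = (fst ` R, R)"
  have R_diag: "x \<in> fst ` R \<longleftrightarrow> (x, x) \<in> R" for x
    using refl_graph_limit(1)[OF K] unfolding R_def by force
  have R_sub: "R \<subseteq> fst ` R \<times> fst ` R"
    using refl_graph_limit[OF K] unfolding R_def by force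
  have "compact R"
    using compact_Int_closed[OF compact_Times[OF C(1,1)] closed_graph_limit[of P]]
    unfolding R_def Int_absorb1[OF graph_limit_subset[OF K C(2,1)]] .
  have near: "\<exists>N. \<forall>n\<ge>N. (\<forall>a\<in>snd (P n). \<exists>p\<in>R. dist2 a p \<le> e) \<and> (\<forall>p\<in>R. \<exists>a\<in>snd (P n). dist2 a p \<le> e)"
    if e: "e > 0" for e
  proof -
    obtain N where N: "\<And>m n. m \<ge> N \<Longrightarrow> n \<ge> N \<Longrightarrow> d_part (P m) (P n) < e/2"
      using cau e unfolding tot.MCauchy_def by (meson half_gt_zero)
    have "\<exists>p\<in>R. dist2 a p \<le> e" if "n \<ge> N" "a \<in> snd (P n)" for n a
    proof -
      have "d_part (P n) (P m) < e/2" if "m \<ge> n" for m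
        using N[of n m] \<open>n \<ge> N\<close> that by simp
      from graph_limit_near[OF cau C this \<open>a \<in> snd (P n)\<close>]
      obtain p where "p \<in> R" "dist2 a p \<le> e/2" unfolding R_def by blast
      with \<open>e > 0\<close> show ?thesis by force
    qed
    moreover have "\<exists>a\<in>snd (P n). dist2 a p \<le> e" if "n \<ge> N" "p \<in> R" for n p
    proof -
      have "\<forall>\<^sub>F m in sequentially. \<exists>q\<in>snd (P m). dist2 p q < e/2"
        using that \<open>e > 0\<close> unfolding R_def by (intro graph_limit_eventually half_gt_zero)
      then obtain M where "\<And>m. m \<ge> M \<Longrightarrow> \<exists>q\<in>snd (P m). dist2 p q < e/2"
        unfolding eventually_sequentially by blast
      from this[of "max M N"] obtain m q where m: "m \<ge> N" "q \<in> snd (P m)" "dist2 p q < e/2"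
        using max.cobounded1 max.cobounded2 by blast
      obtain a where "a \<in> snd (P n)" "dist2 q a \<le> d_part (P m) (P n)"
        using d_part_witness[OF K K m(2)] by blast
      moreover have "dist2 a p \<le> e"
        using dist2_triangle[of p a q] calculation(2) m(3) N[OF m(1) that(1)] by (simp add: dist2_commute)
      ultimately show ?thesis by blast
    qed
    ultimately show ?thesis by blast
  qed
  have "R \<noteq> {}"
  proof -
    obtain N where "\<forall>a\<in>snd (P N). \<exists>p\<in>R. dist2 a p \<le> 1" using near[of 1] by auto
    then show ?thesis using K_totD(2,4)[OF K[of N]] by blast
  qed
  have "Q \<in> K_tot"
    unfolding K_tot_def order_on_defs
  proof (intro CollectI conjI)
    show "compact (fst Q)"
      unfolding Q_def by (auto intro!: compact_continuous_image continuous_intros \<open>compact R\<close>)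
    show "fst Q \<noteq> {}" using \<open>R \<noteq> {}\<close> by (simp add: Q_def)
    show "snd Q \<subseteq> fst Q \<times> fst Q" using R_sub by (simp add: Q_def)
    show "refl_on (fst Q) (snd Q)" using R_diag by (simp add: Q_def refl_on_def)
    show "trans (snd Q)"
      using trans_graph_limit[OF mm cau] unfolding Q_def R_def trans_def by auto
    show "antisym (snd Q)"
      using antisym_graph_limit[OF mm K] unfolding Q_def R_def antisym_def by auto
    show "total_on (fst Q) (snd Q)"
      using total_graph_limit[OF cau] R_diag unfolding Q_def R_def total_on_def by auto
    have "ordered_pairs Q = R" using R_sub by (auto simp: ordered_pairs_def Q_def)
    then show "closedin (top_of_set (fst Q \<times> fst Q)) (ordered_pairs Q)"
      using R_sub compact_imp_closed[OF \<open>compact R\<close>] by (simp add: Q_def closed_subset)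
  qed
  have "limitin tot.mtopology P Q sequentially"
    unfolding tot.limit_metric_sequentially
  proof (intro conjI allI impI)
    fix e :: real assume "e > 0"
    then obtain N where N: "\<forall>n\<ge>N. (\<forall>a\<in>snd (P n). \<exists>p\<in>R. dist2 a p \<le> e/2) \<and>
        (\<forall>p\<in>R. \<exists>a\<in>snd (P n). dist2 a p \<le> e/2)"
      using near half_gt_zero by blast
    have "d_part (P n) Q \<le> e/2" if "n \<ge> N" for n
      using N that by (intro d_part_le K \<open>Q \<in> K_tot\<close>) (auto simp: Q_def)
    then show "\<exists>N. \<forall>n\<ge>N. P n \<in> K_tot \<and> d_part (P n) Q < e"
      using K \<open>e > 0\<close> by (smt (verit) field_sum_of_halves)
  qed (rule \<open>Q \<in> K_tot\<close>)
  then show thesis by (rule that)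
qed


section \<open>The compactness criterion\<close>

lemma uniform_mismatch_subset: "uniform_mismatch \<B> \<Longrightarrow> \<A> \<subseteq> \<B> \<Longrightarrow> uniform_mismatch \<A>"
  unfolding uniform_mismatch_def by (meson subsetD)

text \<open>
  By the Bolzano-Weierstrass criterion for relatively compact sets it suffices to find accumulation points
  of infinite subsets of \<open>\<A>\<close> itself. An injective sequence is taken in order that its limit is an
  accumulation point of its range.
\<close>

lemma compactin_closure_if_uniform_mismatch:
  assumes A: "\<A> \<subseteq> K_tot" and C: "compact C" "\<And>P. P \<in> \<A> \<Longrightarrow> fst P \<subseteq> C"
    and mm: "uniform_mismatch \<A>"
  shows "compactin tot.mtopology (tot.mtopology closure_of \<A>)"
  unfolding tot.compact_closure_of_eq_Bolzano_Weierstrass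
proof (intro allI impI)
  fix T assume T: "infinite T \<and> T \<subseteq> \<A> \<and> T \<subseteq> K_tot"
  then obtain \<sigma> :: "nat \<Rightarrow> _" where \<sigma>: "inj \<sigma>" "range \<sigma> \<subseteq> T"
    using infinite_countable_subset by blast
  obtain r where r: "strict_mono r" "tot.MCauchy (\<sigma> \<circ> r)"
    using mtotally_bounded_common_carrier[OF assms(1-3)] \<sigma>(2) T
    unfolding tot.mtotally_bounded_sequentially by (meson order_trans)
  have sub: "range (\<sigma> \<circ> r) \<subseteq> \<A>" using \<sigma>(2) T by auto
  obtain Q where Q: "limitin tot.mtopology (\<sigma> \<circ> r) Q sequentially"
    using MCauchy_limit_exists[OF uniform_mismatch_subset[OF mm sub] r(2) C(1)] C(2) sub
    by (metis image_subset_iff UNIV_I)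
  have inj: "inj (\<sigma> \<circ> r)"
    using \<sigma>(1) strict_mono_imp_inj_on[OF r(1)] by (simp add: inj_compose)
  have "Q \<in> tot.mtopology derived_set_of T"
    unfolding tot.metric_derived_set_of
  proof (intro CollectI conjI allI impI)
    show "Q \<in> K_tot" using Q tot.limitin_mspace by blast
    fix e :: real assume "e > 0"
    then obtain N where N: "\<And>n. n \<ge> N \<Longrightarrow> (\<sigma> \<circ> r) n \<in> K_tot \<and> d_part ((\<sigma> \<circ> r) n) Q < e"
      using Q unfolding tot.limit_metric_sequentially by blast
    have "(\<sigma> \<circ> r) N \<noteq> (\<sigma> \<circ> r) (Suc N)" using inj by (metis injD n_not_Suc_n)
    then obtain n where n: "n \<ge> N" "(\<sigma> \<circ> r) n \<noteq> Q" by (metis le_refl le_Suc_eq)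
    have "(\<sigma> \<circ> r) n \<in> T" using \<sigma>(2) by auto
    with n N[OF n(1)] \<open>Q \<in> K_tot\<close> show "\<exists>y\<in>T. y \<noteq> Q \<and> y \<in> tot.mball Q e"
      by (metis tot.commute tot.in_mball)
  qed
  then show "tot.mtopology derived_set_of T \<noteq> {}" by blast
qed

theorem theorem1p15:
  fixes \<A> :: "('a::metric_space set \<times> 'a rel) set"
  assumes "\<A> \<subseteq> K_tot"
  shows "compactin ordered_hausdorff_topology (ordered_hausdorff_topology closure_of \<A>) \<longleftrightarrow>
         (\<exists>C. compact C \<and> (\<forall>P\<in>\<A>. fst P \<subseteq> C)) \<and>
         ((\<lambda>\<epsilon>. SUP P\<in>\<A>. mismatch_modulus \<epsilon> P) \<longlongrightarrow> 0) (at_right 0)"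
  unfolding ordered_hausdorff_topology_def uniform_mismatch_iff_tendsto[symmetric]
proof
  assume L: "compactin tot.mtopology (tot.mtopology closure_of \<A>)"
  have sub: "\<A> \<subseteq> tot.mtopology closure_of \<A>" using assms by (simp add: closure_of_subset)
  then show "(\<exists>C. compact C \<and> (\<forall>P\<in>\<A>. fst P \<subseteq> C)) \<and> uniform_mismatch \<A>"
    using compact_Union_carriers[OF L]
      uniform_mismatch_subset[OF compactin_imp_uniform_mismatch[OF L] sub] by blast
next
  assume "(\<exists>C. compact C \<and> (\<forall>P\<in>\<A>. fst P \<subseteq> C)) \<and> uniform_mismatch \<A>"
  then show "compactin tot.mtopology (tot.mtopology closure_of \<A>)"
    using compactin_closure_if_uniform_mismatch[OF assms] by blast
qed

end
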